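(* For any (deterministic, non-negative) sequence $(m_n)_{n\ge 1}$ satisfying $m_n=o(n)$, almost surely $$\lim_{n\to\infty}X_n^{\ge m_n}=\infty .$$
   Context: The random friend tree process $(T_n)_{n\ge 2}$ is defined as follows. $T_2$ is a single edge joining vertices labelled $1$ and $2$. For $n\ge 2$, given $T_n$ (and the past of the process), $V_n$ is chosen uniformly at random in $\{1,\dots,n\}$, and then $W_n$ is a uniformly random neighbour of $V_n$ in $T_n$; $T_{n+1}$ is obtained from $T_n$ by adding a new vertex labelled $n+1$ joined by an edge to $W_n$. Thus $T_n$ is a tree with vertex set $[n]=\{1,\dots,n\}$. $X_n^{\ge m}$ denotes the number of vertices of $T_n$ whose degree in $T_n$ is at least $m$. *)

theory Defs
  imports "HOL-Probability.Probability" "HOL-Library.Landau_Symbols"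
begin

text \<open>An undirected graph is a pair of a vertex set and a set of edges, an edge joining
  \<open>u\<close> and \<open>v\<close> being the set \<open>{u, v}\<close>.\<close>

type_synonym graph = "nat set \<times> nat set set"

definition verts :: "graph \<Rightarrow> nat set" where
  "verts G = fst G"

definition edges :: "graph \<Rightarrow> nat set set" where
  "edges G = snd G"

definition neighbours :: "graph \<Rightarrow> nat \<Rightarrow> nat set" where
  "neighbours G v = {u \<in> verts G. {u, v} \<in> edges G}"

definition degree :: "graph \<Rightarrow> nat \<Rightarrow> nat" where
  "degree G v = card (neighbours G v)"

definition add_leaf :: "nat \<Rightarrow> nat \<Rightarrow> graph \<Rightarrow> graph" where
  "add_leaf x w G = (insert x (verts G), insert {x, w} (edges G))"

text \<open>The conditioning events in the laws of \<open>V n\<close> and \<open>W n\<close> fix \<open>T n\<close> together with the whole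
  past \<open>(T k, V k, W k)\<close>, \<open>2 \<le> k < n\<close>. As this data is discrete, elementary conditional
  probabilities given the events of positive probability suffice. On such an event \<open>v\<close> lies
  in \<open>{1..n}\<close> and has a neighbour in \<open>t\<close>, so that \<open>pmf_of_set\<close> is the uniform distribution.\<close>

locale random_friend_tree = prob_space M
  for M :: "'a measure" +
  fixes V W :: "nat \<Rightarrow> 'a \<Rightarrow> nat"
    and T :: "nat \<Rightarrow> 'a \<Rightarrow> graph"
  assumes V_measurable: "2 \<le> n \<Longrightarrow> V n \<in> measurable M (count_space UNIV)"
    and W_measurable: "2 \<le> n \<Longrightarrow> W n \<in> measurable M (count_space UNIV)"
    and T_2: "\<omega> \<in> space M \<Longrightarrow> T 2 \<omega> = ({1, 2}, {{1, 2}})"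
    and T_Suc: "2 \<le> n \<Longrightarrow> \<omega> \<in> space M \<Longrightarrow> T (n + 1) \<omega> = add_leaf (n + 1) (W n \<omega>) (T n \<omega>)"
    and V_law: "2 \<le> n \<Longrightarrow>
      0 < \<P>(\<omega> in M. T n \<omega> = t \<and> map (\<lambda>k. (T k \<omega>, V k \<omega>, W k \<omega>)) [2..<n] = past) \<Longrightarrow>
      \<P>(\<omega> in M. V n \<omega> = v \<bar>
          T n \<omega> = t \<and> map (\<lambda>k. (T k \<omega>, V k \<omega>, W k \<omega>)) [2..<n] = past)
        = pmf (pmf_of_set {1..n}) v"
    and W_law: "2 \<le> n \<Longrightarrow>
      0 < \<P>(\<omega> in M. T n \<omega> = t \<and> map (\<lambda>k. (T k \<omega>, V k \<omega>, W k \<omega>)) [2..<n] = past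
                \<and> V n \<omega> = v) \<Longrightarrow>
      \<P>(\<omega> in M. W n \<omega> = w \<bar>
          T n \<omega> = t \<and> map (\<lambda>k. (T k \<omega>, V k \<omega>, W k \<omega>)) [2..<n] = past \<and> V n \<omega> = v)
        = pmf (pmf_of_set (neighbours t v)) w"

definition num_deg_ge :: "graph \<Rightarrow> real \<Rightarrow> nat" where
  "num_deg_ge G m = card {v \<in> verts G. m \<le> real (degree G v)}"

end

theory Submission
  imports Defs
begin

text \<open>
  Almost surely infinitely many vertices have a degree that grows linearly in \<open>n\<close>; since
  \<open>m n = o(n)\<close>, any \<open>Z\<close> of them eventually have degree at least \<open>m n\<close>.

  Let \<open>w\<close> have degree \<open>D\<close> and \<open>L\<close> leaf neighbours at time \<open>n\<close>. Every leaf neighbour sends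
  the new vertex to \<open>w\<close> whenever it is the chosen \<open>V n\<close>, so \<open>w\<close> gains a leaf with probability
  at least \<open>L / n\<close>. It loses one only if the new vertex is attached to one of its leaves, which
  requires \<open>V n = w\<close> and so has probability \<open>L / (n D) \<le> 1 / n\<close>. So \<open>L\<close> behaves like a Polya urn
  with a bounded rate of loss, and the fate of \<open>w\<close> is controlled by superharmonic functions
  of the history.

  \<^item> If \<open>L \<ge> 6\<close>, then \<open>n / (L - 4)\<close> is a supermartingale until \<open>L\<close> drops to \<open>5\<close>, and the maximal
    inequality shows that it never doubles with probability at least \<open>1 / 2\<close>; then \<open>L\<close> grows
    linearly (\<open>prob_not_linear_many_leaves\<close>).
  \<^item> If \<open>L \<ge> 1\<close> and \<open>D \<ge> 2\<close>, the supermartingale \<open>(14 + ln n) (1 - L / 7)\<close> shows that \<open>L\<close> reaches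
    \<open>6\<close> before \<open>0\<close> with probability bounded below (\<open>prob_not_linear_one_leaf\<close>).
  \<^item> At every time \<open>n \<ge> 3\<close> some vertex has leaves as all but at most one of its neighbours. So the
    new vertex is attached to a leaf with probability at least \<open>1 / (2 n)\<close>, a divergent series.
    Such a leaf becomes a vertex with \<open>L = 1\<close> and \<open>D = 2\<close> that had never had degree \<open>2\<close> before
    (\<open>prob_no_new_linear\<close>).

  Thus, given any history, with conditional probability at least \<open>1 / 14\<close> a vertex outside a
  given finite set of non-leaves acquires linear degree. An argument in the style of Levy's
  zero-one law (\<open>prob_eq_0_if_cyl_le\<close>) makes this probability one, which excludes every
  finite set as the set of vertices of linear degree.\<close>

section \<open>Recursive trees\<close>

inductive recursive_tree :: "nat \<Rightarrow> graph \<Rightarrow> bool" where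
  edge: "recursive_tree 2 ({1, 2}, {{1, 2}})"
| leaf: "recursive_tree n t \<Longrightarrow> w \<in> verts t \<Longrightarrow> recursive_tree (Suc n) (add_leaf (Suc n) w t)"

definition leaves_at :: "graph \<Rightarrow> nat \<Rightarrow> nat set" where
  "leaves_at t w = {x \<in> neighbours t w. degree t x = 1}"

text \<open>The conditional probability that the new vertex is attached to \<open>w\<close>: some neighbour \<open>v\<close>
  of \<open>w\<close> is chosen first, and then \<open>w\<close> among the neighbours of \<open>v\<close>.\<close>

definition attach_prob :: "graph \<Rightarrow> nat \<Rightarrow> real" where
  "attach_prob t w = (\<Sum>v\<in>neighbours t w. 1 / degree t v) / card (verts t)"

lemma neighbours_subset_verts: "neighbours t v \<subseteq> verts t"
  by (auto simp: neighbours_def)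

lemma neighbours_sym: "u \<in> neighbours t v \<Longrightarrow> v \<in> verts t \<Longrightarrow> v \<in> neighbours t u"
  by (auto simp: neighbours_def insert_commute)

lemma verts_add_leaf [simp]: "verts (add_leaf x w t) = insert x (verts t)"
  by (simp add: add_leaf_def verts_def)

lemma edges_add_leaf [simp]: "edges (add_leaf x w t) = insert {x, w} (edges t)"
  by (simp add: add_leaf_def edges_def)

lemma neighbours_add_leaf:
  assumes "edges t \<subseteq> Pow (verts t)" "x \<notin> verts t" "w \<in> verts t"
  shows "neighbours (add_leaf x w t) v =
    (if v = x then {w} else if v = w then insert x (neighbours t v) else neighbours t v)"
  using assms by (auto simp: neighbours_def doubleton_eq_iff)

context
  fixes n t
  assumes rt: "recursive_tree n t"
begin

lemma recursive_tree_ge_2: "n \<ge> 2"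
  using rt by induction auto

lemma recursive_tree_verts: "verts t = {1..n}"
  using rt
proof induction
  case edge
  show ?case by (auto simp: verts_def)
next
  case (leaf n t w)
  then show ?case by auto
qed

lemma recursive_tree_finite: "finite (verts t)"
  by (simp add: recursive_tree_verts)

lemma recursive_tree_edges: "edges t \<subseteq> Pow (verts t)"
  using rt
proof induction
  case edge
  show ?case by (auto simp: verts_def edges_def)
next
  case (leaf n t w)
  then show ?case by auto
qed

lemma finite_neighbours: "finite (neighbours t v)"
  using finite_subset[OF neighbours_subset_verts recursive_tree_finite] .

lemma neighbours_add_vertex:
  assumes "w \<in> verts t"
  shows "neighbours (add_leaf (Suc n) w t) v =
    (if v = Suc n then {w} else if v = w then insert (Suc n) (neighbours t v)
     else neighbours t v)"
  by (rule neighbours_add_leaf) (use assms recursive_tree_edges in \<open>auto simp: recursive_tree_verts\<close>)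

lemma degree_add_vertex:
  assumes "w \<in> verts t"
  shows "degree (add_leaf (Suc n) w t) v =
    (if v = Suc n then 1 else if v = w then degree t v + 1 else degree t v)"
proof -
  have "Suc n \<notin> neighbours t v"
    using neighbours_subset_verts[of t v] recursive_tree_verts by auto
  then show ?thesis
    using finite_neighbours[of v] by (auto simp: degree_def neighbours_add_vertex[OF assms])
qed

lemma degree_pos: "v \<in> verts t \<Longrightarrow> 0 < degree t v"
  using rt
proof induction
  case edge
  have "neighbours ({1, 2}, {{1, 2}}) v = {1, 2} - {v}"
    using edge by (auto simp: neighbours_def verts_def edges_def doubleton_eq_iff)
  then show ?case using edge by (auto simp: degree_def verts_def)
next
  case (leaf n t w)
  show ?case
    using leaf.prems leaf.IH Submission.degree_add_vertex[OF leaf.hyps] by auto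
qed

lemma not_self_neighbour: "v \<notin> neighbours t v"
  using rt
proof induction
  case edge
  show ?case by (auto simp: neighbours_def verts_def edges_def doubleton_eq_iff)
next
  case (leaf n t w)
  then show ?case
    using Submission.neighbours_add_vertex[OF leaf.hyps, of v] Submission.recursive_tree_verts[OF leaf.hyps(1)]
    by auto
qed

lemma finite_leaves_at: "finite (leaves_at t w)"
  using finite_neighbours by (simp add: leaves_at_def)

lemma card_leaves_at_le_degree: "card (leaves_at t w) \<le> degree t w"
  unfolding leaves_at_def degree_def by (intro card_mono finite_neighbours) auto

lemma leaves_at_add_vertex:
  assumes "x \<in> verts t" "w \<in> verts t"
  shows "leaves_at (add_leaf (Suc n) x t) w =
    (if x = w then insert (Suc n) (leaves_at t w) else leaves_at t w - {x})"
  using assms neighbours_subset_verts[of t w] degree_pos[of x] not_self_neighbour[of w]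
  by (auto simp: leaves_at_def neighbours_add_vertex degree_add_vertex recursive_tree_verts)

lemma card_leaves_at_add_vertex:
  assumes "x \<in> verts t" "w \<in> verts t"
  shows "card (leaves_at (add_leaf (Suc n) x t) w) =
    (if x = w then card (leaves_at t w) + 1
     else if x \<in> leaves_at t w then card (leaves_at t w) - 1 else card (leaves_at t w))"
proof -
  have "Suc n \<notin> leaves_at t w"
    using neighbours_subset_verts[of t w] recursive_tree_verts by (auto simp: leaves_at_def)
  then show ?thesis
    using finite_leaves_at by (simp add: leaves_at_add_vertex[OF assms])
qed

lemma not_self_leaf: "w \<notin> leaves_at t w"
  using not_self_neighbour by (simp add: leaves_at_def)

lemma neighbours_leaf:
  assumes "x \<in> leaves_at t w" "w \<in> verts t"
  shows "neighbours t x = {w}"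
proof -
  have "card (neighbours t x) = 1" "w \<in> neighbours t x"
    using assms by (auto simp: leaves_at_def degree_def intro: neighbours_sym)
  then show ?thesis
    by (metis card_1_singletonE singletonD)
qed

lemma sum_attach_prob_mult:
  "(\<Sum>w\<in>verts t. attach_prob t w * g w)
    = (\<Sum>v\<in>verts t. \<Sum>w\<in>neighbours t v. g w / (real n * real (degree t v)))"
proof -
  have "attach_prob t w * g w =
      (\<Sum>v | v \<in> verts t \<and> w \<in> neighbours t v. g w / (real n * real (degree t v)))"
    if "w \<in> verts t" for w
  proof -
    have "{v \<in> verts t. w \<in> neighbours t v} = neighbours t w"
      using neighbours_subset_verts[of t] that by (auto intro: neighbours_sym)
    then show ?thesis
      by (simp add: attach_prob_def recursive_tree_verts sum_divide_distrib sum_distrib_left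
          mult.commute)
  qed
  then have "(\<Sum>w\<in>verts t. attach_prob t w * g w)
      = (\<Sum>w\<in>verts t. \<Sum>v | v \<in> verts t \<and> w \<in> neighbours t v.
          g w / (real n * real (degree t v)))"
    by simp
  also have "\<dots> = (\<Sum>v\<in>verts t. \<Sum>w | w \<in> verts t \<and> w \<in> neighbours t v.
          g w / (real n * real (degree t v)))"
    by (intro sum.swap_restrict recursive_tree_finite)
  also have "\<dots> = (\<Sum>v\<in>verts t. \<Sum>w\<in>neighbours t v. g w / (real n * real (degree t v)))"
    using neighbours_subset_verts[of t]
    by (intro sum.cong refl) auto
  finally show ?thesis .
qed

lemma sum_inverse_degrees:
  "(\<Sum>v\<in>verts t. \<Sum>w\<in>neighbours t v. 1 / (real n * real (degree t v))) = 1"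
proof -
  have "(\<Sum>w\<in>neighbours t v. 1 / (real n * real (degree t v))) = 1 / n" if "v \<in> verts t" for v
    using degree_pos[OF that] by (simp add: degree_def)
  then show ?thesis
    using recursive_tree_ge_2 by (simp add: recursive_tree_verts)
qed

lemma sum_attach_prob: "(\<Sum>w\<in>verts t. attach_prob t w) = 1"
  using sum_attach_prob_mult[of "\<lambda>_. 1"] sum_inverse_degrees by simp

lemma attach_prob_nonneg: "0 \<le> attach_prob t w"
  by (auto simp: attach_prob_def intro!: divide_nonneg_nonneg sum_nonneg)

text \<open>A leaf has only one neighbour to pass the new vertex to, so each leaf at \<open>w\<close> contributes
  a full \<open>1 / n\<close>.\<close>

lemma attach_prob_ge: "real (card (leaves_at t w)) / n \<le> attach_prob t w"
proof -
  have "real (card (leaves_at t w)) = (\<Sum>v\<in>leaves_at t w. 1 / real (degree t v))"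
    by (simp add: leaves_at_def)
  also have "\<dots> \<le> (\<Sum>v\<in>neighbours t w. 1 / real (degree t v))"
    by (intro sum_mono2 finite_neighbours) (auto simp: leaves_at_def)
  finally show ?thesis
    by (simp add: attach_prob_def recursive_tree_verts divide_right_mono)
qed

lemma sum_attach_prob_leaves_at:
  assumes "w \<in> verts t"
  shows "(\<Sum>x\<in>leaves_at t w. attach_prob t x) = card (leaves_at t w) / (n * degree t w)"
proof -
  have "(\<Sum>x\<in>leaves_at t w. attach_prob t x) = (\<Sum>x\<in>leaves_at t w. 1 / (n * degree t w))"
    using neighbours_leaf[OF _ assms]
    by (intro sum.cong refl) (simp add: attach_prob_def recursive_tree_verts)
  then show ?thesis by simp
qed

text \<open>The drift estimate behind all three supermartingales: \<open>a\<close> is the value if the new vertex is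
  attached neither to \<open>w\<close> nor to a leaf at \<open>w\<close>, \<open>b\<close> the decrease when \<open>w\<close> gains a leaf, and \<open>d\<close>
  the increase when it loses one.\<close>

lemma mean_attach_le:
  assumes w: "w \<in> verts t" and "0 \<le> b"
    and g: "\<And>x. x \<in> verts t \<Longrightarrow>
      g x \<le> a - b * of_bool (x = w) + d * of_bool (x \<in> leaves_at t w)"
  shows "(\<Sum>x\<in>verts t. attach_prob t x * g x)
    \<le> a - b * (card (leaves_at t w) / n) + d * (card (leaves_at t w) / (n * degree t w))"
proof -
  have sub: "leaves_at t w \<subseteq> verts t"
    using neighbours_subset_verts[of t] by (auto simp: leaves_at_def)
  have "(\<Sum>x\<in>verts t. attach_prob t x * g x)
    \<le> (\<Sum>x\<in>verts t. attach_prob t x *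
        (a - b * of_bool (x = w) + d * of_bool (x \<in> leaves_at t w)))"
    using g attach_prob_nonneg by (intro sum_mono mult_left_mono) auto
  also have "\<dots> = a * (\<Sum>x\<in>verts t. attach_prob t x)
      - b * (\<Sum>x\<in>verts t. attach_prob t x * of_bool (x = w))
      + d * (\<Sum>x\<in>verts t. attach_prob t x * of_bool (x \<in> leaves_at t w))"
    by (simp add: algebra_simps sum.distrib sum_subtractf sum_distrib_left)
  also have "(\<Sum>x\<in>verts t. attach_prob t x * of_bool (x = w)) = attach_prob t w"
    using w recursive_tree_finite by (simp add: of_bool_def if_distrib sum.delta cong: if_cong)
  also have "(\<Sum>x\<in>verts t. attach_prob t x * of_bool (x \<in> leaves_at t w))
      = (\<Sum>x\<in>leaves_at t w. attach_prob t x)"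
    using sub recursive_tree_finite
    by (intro sum.mono_neutral_cong_right) auto
  finally show ?thesis
    using mult_left_mono[OF attach_prob_ge[of w] \<open>0 \<le> b\<close>]
    by (simp add: sum_attach_prob sum_attach_prob_leaves_at[OF w])
qed

end

text \<open>Such a vertex keeps its property under every attachment except one to its own leaves, and a
  leaf that receives the new vertex has the property itself. This gives directly a leaf-rich vertex at each time,
  without a longest path argument.\<close>

lemma exists_mostly_leaves:
  assumes "recursive_tree n t" "3 \<le> n"
  shows "\<exists>w\<in>verts t. 2 \<le> degree t w \<and> leaves_at t w \<noteq> {} \<and>
    degree t w \<le> card (leaves_at t w) + 1"
  using assms
proof induction
  case edge
  then show ?case by simp
next
  case (leaf n t x)
  note up = degree_add_vertex[OF leaf.hyps] leaves_at_add_vertex[OF leaf.hyps(1,2)]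
    card_leaves_at_add_vertex[OF leaf.hyps(1,2)]
  have fin: "finite (leaves_at t v)" for v
    by (rule finite_leaves_at[OF leaf.hyps(1)])
  have vs: "verts t = {1..n}" by (rule recursive_tree_verts[OF leaf.hyps(1)])
  have new: "x \<noteq> Suc n" using leaf.hyps(2) vs by simp
  have not_old: "Suc n \<notin> leaves_at t v" for v
    using neighbours_subset_verts[of t v] vs by (auto simp: leaves_at_def)
  consider "degree t x = 1" | "degree t x \<ge> 2" "n = 2" | "degree t x \<ge> 2" "n \<ge> 3"
    using recursive_tree_ge_2[OF leaf.hyps(1)] degree_pos[OF leaf.hyps] by linarith
  then show ?case
  proof cases
    case 1
    then show ?thesis
      using leaf.hyps(2) fin[of x] new not_old by (intro bexI[of _ x]) (auto simp: up)
  next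
    case 2
    \<comment> \<open>The initial edge has no vertex of degree 2.\<close>
    have "neighbours t x \<subseteq> {1..2} - {x}"
      using not_self_neighbour[OF leaf.hyps(1), of x] neighbours_subset_verts[of t x] vs 2 by auto
    then have "degree t x \<le> card ({1..2} - {x})"
      unfolding degree_def by (intro card_mono) auto
    also have "\<dots> = 1"
      using leaf.hyps(2) vs 2 by simp
    finally show ?thesis using 2 by simp
  next
    case 3
    then obtain w where w: "w \<in> verts t" "2 \<le> degree t w" "leaves_at t w \<noteq> {}"
      "degree t w \<le> card (leaves_at t w) + 1"
      using leaf.IH by auto
    have "x \<notin> leaves_at t w"
      using 3 by (auto simp: leaves_at_def)
    then show ?thesis
      using w vs fin[of x] not_old[of x] by (intro bexI[of _ w]) (auto simp: up)
  qed
qed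

section \<open>A slowly growing weight\<close>

text \<open>Any positive increasing weight that tends to infinity and satisfies \<open>growth (k + 1) \<le> (1 + 1 / (14 k)) growth k\<close>
  would do: the small relative growth preserves supermartingales with a drift of order \<open>1 / k\<close>,
  and the divergence rules out that nothing happens forever. The constant 14 turns the
  increment \<open>1 / k\<close> of the logarithm into the relative increment \<open>1 / (14 k)\<close>.\<close>

definition growth :: "nat \<Rightarrow> real" where
  "growth k = 14 + ln k"

lemma growth_ge: "1 \<le> k \<Longrightarrow> 14 \<le> growth k"
  by (simp add: growth_def)

lemma growth_Suc:
  assumes "1 \<le> k"
  shows "growth k \<le> growth (Suc k)" "growth (Suc k) \<le> growth k + 1 / k"
proof -
  have "real (Suc k) = real k * (1 + 1 / real k)"
    using assms by (simp add: field_simps)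
  moreover have "ln (real k * (1 + 1 / real k)) = ln (real k) + ln (1 + 1 / real k)"
    using assms by (intro ln_mult_pos) (auto intro: add_pos_nonneg)
  ultimately have "ln (real (Suc k)) - ln (real k) = ln (1 + 1 / real k)"
    by simp
  also have "\<dots> \<le> 1 / real k"
    by (intro ln_add_one_self_le_self) simp
  finally show "growth (Suc k) \<le> growth k + 1 / k"
    by (simp add: growth_def)
qed (use assms in \<open>simp add: growth_def\<close>)

lemma growth_at_top: "filterlim growth at_top sequentially"
  unfolding growth_def
  by (intro filterlim_tendsto_add_at_top[OF tendsto_const]
      filterlim_compose[OF ln_at_top filterlim_real_sequentially])

section \<open>Histories\<close>

text \<open>A history lists the choices \<open>(V k, W k)\<close>, the most recent one first. The history \<open>h\<close> leads
  to time \<open>length h + 2\<close>, as the process starts at time 2. Unlike graphs, histories form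
  a countable type.\<close>

primrec build :: "(nat \<times> nat) list \<Rightarrow> graph" where
  "build [] = ({1, 2}, {{1, 2}})"
| "build (s # h) = add_leaf (Suc (length h + 2)) (snd s) (build h)"

text \<open>The value, given a history, of the record of trees and choices on which the laws of
  \<open>V n\<close> and \<open>W n\<close> are conditioned.\<close>

primrec past_of :: "(nat \<times> nat) list \<Rightarrow> (graph \<times> nat \<times> nat) list" where
  "past_of [] = []"
| "past_of (s # h) = past_of h @ [(build h, s)]"

context random_friend_tree
begin

text \<open>The cylinder event that the choices made before time \<open>length h + 2\<close> are those in \<open>h\<close>.\<close>

primrec cyl :: "(nat \<times> nat) list \<Rightarrow> 'a set" where
  "cyl [] = space M"
| "cyl (s # h) = {\<omega> \<in> cyl h. (V (length h + 2) \<omega>, W (length h + 2) \<omega>) = s}"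

lemma cyl_subset_space: "cyl h \<subseteq> space M"
  by (induction h) auto

lemma T_cyl: "\<omega> \<in> cyl h \<Longrightarrow> T (length h + 2) \<omega> = build h"
proof (induction h arbitrary: \<omega>)
  case Nil
  then show ?case using T_2 by (simp add: numeral_2_eq_2)
next
  case (Cons s h)
  have "T (length h + 2 + 1) \<omega> = add_leaf (length h + 2 + 1) (W (length h + 2) \<omega>) (T (length h + 2) \<omega>)"
    using Cons.prems cyl_subset_space by (intro T_Suc) auto
  then show ?case
    using Cons by auto
qed

lemma T_eq_on_cyl:
  "\<omega> \<in> cyl h \<Longrightarrow> \<omega>' \<in> cyl h \<Longrightarrow> 2 \<le> k \<Longrightarrow> k \<le> length h + 2 \<Longrightarrow> T k \<omega> = T k \<omega>'"
proof (induction h)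
  case Nil
  then have "k = length [] + 2" by simp
  then show ?case using T_cyl[of \<omega> "[]"] T_cyl[of \<omega>' "[]"] Nil by simp
next
  case (Cons s h)
  show ?case
  proof (cases "k \<le> length h + 2")
    case False
    then have "k = length (s # h) + 2" using Cons.prems by simp
    then show ?thesis using T_cyl[of _ "s # h"] Cons.prems(1,2) by metis
  qed (use Cons in auto)
qed

lemma past_eq_iff:
  assumes "\<omega> \<in> space M"
  shows "map (\<lambda>k. (T k \<omega>, V k \<omega>, W k \<omega>)) [2..<length h + 2] = past_of h \<longleftrightarrow> \<omega> \<in> cyl h"
proof (induction h)
  case Nil
  then show ?case using assms by simp
next
  case (Cons s h)
  have "[2..<length (s # h) + 2] = [2..<length h + 2] @ [length h + 2]"
    by simp
  then show ?case
    using Cons T_cyl[of \<omega> h] by auto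
qed

lemma cyl_measurable [measurable]: "cyl h \<in> events"
proof (induction h)
  case (Cons s h)
  define n where "n = length h + 2"
  have [measurable]: "V n \<in> measurable M (count_space UNIV)"
    "W n \<in> measurable M (count_space UNIV)"
    by (auto simp: n_def intro: V_measurable W_measurable)
  note [measurable] = Cons.IH
  have "cyl (s # h) = cyl h \<inter> {\<omega> \<in> space M. V n \<omega> = fst s}
      \<inter> {\<omega> \<in> space M. W n \<omega> = snd s}"
    using cyl_subset_space[of h] by (auto simp: n_def)
  also have "\<dots> \<in> events"
    by measurable
  finally show ?case .
qed simp

lemma prob_cyl_Cons:
  assumes rt: "recursive_tree (length h + 2) (build h)"
  shows "prob (cyl ((v, w) # h)) = prob (cyl h) *
    (if v \<in> verts (build h) \<and> w \<in> neighbours (build h) v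
     then 1 / (real (length h + 2) * real (degree (build h) v)) else 0)"
proof -
  define n where "n = length h + 2"
  have n: "2 \<le> n" by (simp add: n_def)
  note vs = recursive_tree_verts[OF rt, folded n_def]
  \<comment> \<open>The tree is a function of the choices, so conditioning on the record of trees and choices
    is conditioning on \<open>cyl h\<close>.\<close>
  have past: "T n \<omega> = build h \<and> map (\<lambda>k. (T k \<omega>, V k \<omega>, W k \<omega>)) [2..<n] = past_of h
      \<longleftrightarrow> \<omega> \<in> cyl h" if "\<omega> \<in> space M" for \<omega>
    using past_eq_iff[OF that, of h] T_cyl[of \<omega> h] by (auto simp: n_def)
  have ev1: "{\<omega> \<in> space M. T n \<omega> = build h \<and>
      map (\<lambda>k. (T k \<omega>, V k \<omega>, W k \<omega>)) [2..<n] = past_of h} = cyl h"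
    using past cyl_subset_space[of h] by blast
  define E where "E = {\<omega> \<in> cyl h. V n \<omega> = v}"
  have ev2: "{\<omega> \<in> space M. V n \<omega> = v \<and> T n \<omega> = build h \<and>
      map (\<lambda>k. (T k \<omega>, V k \<omega>, W k \<omega>)) [2..<n] = past_of h} = E"
    using past cyl_subset_space[of h] unfolding E_def by blast
  have ev3: "{\<omega> \<in> space M. T n \<omega> = build h \<and>
      map (\<lambda>k. (T k \<omega>, V k \<omega>, W k \<omega>)) [2..<n] = past_of h \<and> V n \<omega> = v} = E"
    using past cyl_subset_space[of h] unfolding E_def by blast
  have ev4: "{\<omega> \<in> space M. W n \<omega> = w \<and> T n \<omega> = build h \<and>
      map (\<lambda>k. (T k \<omega>, V k \<omega>, W k \<omega>)) [2..<n] = past_of h \<and> V n \<omega> = v} = cyl ((v, w) # h)"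
    using past cyl_subset_space[of h] unfolding E_def cyl.simps n_def[symmetric] by blast
  have [measurable]: "V n \<in> measurable M (count_space UNIV)"
    by (rule V_measurable[OF n])
  have "E = cyl h \<inter> {\<omega> \<in> space M. V n \<omega> = v}"
    using cyl_subset_space[of h] by (auto simp: E_def)
  then have E [measurable]: "E \<in> events" by simp
  have sub: "cyl ((v, w) # h) \<subseteq> E" "E \<subseteq> cyl h"
    by (auto simp: E_def n_def)
  have V: "prob E = prob (cyl h) * (if v \<in> verts (build h) then 1 / real n else 0)"
  proof (cases "prob (cyl h) = 0")
    case True
    then show ?thesis
      using finite_measure_mono[OF sub(2)] measure_nonneg[of M E] by simp
  next
    case False
    then have "prob E / prob (cyl h) = pmf (pmf_of_set {1..n}) v"
      using V_law[OF n, of "build h" "past_of h" v] unfolding cond_prob_def ev1 ev2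
      by (simp add: zero_less_measure_iff)
    also have "\<dots> = (if v \<in> verts (build h) then 1 / real n else 0)"
      using n vs by (subst pmf_of_set) auto
    finally show ?thesis
      using False by (simp add: field_simps)
  qed
  show ?thesis
  proof (cases "prob E = 0")
    case True
    then have "prob (cyl ((v, w) # h)) = 0"
      using finite_measure_mono[OF sub(1)] by (metis E measure_le_0_iff)
    then show ?thesis
      using True V n by (auto split: if_splits)
  next
    case False
    then have v: "v \<in> verts (build h)"
      using V by (auto split: if_splits)
    from False have "prob (cyl ((v, w) # h)) / prob E = pmf (pmf_of_set (neighbours (build h) v)) w"
      using W_law[OF n, of "build h" "past_of h" v w] unfolding cond_prob_def ev3 ev4
      by (simp add: zero_less_measure_iff)
    also have "\<dots> = (if w \<in> neighbours (build h) v then 1 / real (degree (build h) v) else 0)"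
      using degree_pos[OF rt v] finite_neighbours[OF rt, of v]
      by (subst pmf_of_set) (auto simp: degree_def)
    finally have "prob (cyl ((v, w) # h)) =
        (if w \<in> neighbours (build h) v then 1 / real (degree (build h) v) else 0) * prob E"
      using False by (simp add: divide_eq_eq del: cyl.simps)
    then show ?thesis
      using v V by (simp add: n_def del: cyl.simps)
  qed
qed

lemma recursive_tree_build:
  "0 < prob (cyl h) \<Longrightarrow> recursive_tree (length h + 2) (build h)"
proof (induction h)
  case Nil
  show ?case using recursive_tree.edge by (simp add: numeral_2_eq_2)
next
  case (Cons s h)
  obtain v w where s: "s = (v, w)" by (cases s)
  have "prob (cyl (s # h)) \<le> prob (cyl h)"
    by (intro finite_measure_mono) auto
  with Cons have rt: "recursive_tree (length h + 2) (build h)"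
    by simp
  then have "w \<in> verts (build h)"
    using Cons.prems prob_cyl_Cons[OF rt, of v w] neighbours_subset_verts[of "build h" v]
    unfolding s by (auto split: if_splits)
  then show ?case
    using recursive_tree.leaf[OF rt] by (simp add: s)
qed

lemma cyl_Cons_subset: "cyl (s # h) \<subseteq> cyl h"
  by auto

declare cyl.simps(2) [simp del]

text \<open>The one-step law of total probability; with \<open>g\<close> bounding the conditional probabilities of
  \<open>U\<close> after the next step, it is what makes backward induction over histories work.
  Inequalities are multiplied by \<open>prob (cyl h)\<close> so that null histories need no special case.\<close>

lemma prob_le_mean:
  assumes rt: "recursive_tree (length h + 2) (build h)" and U [measurable]: "U \<in> events"
    and le: "\<And>v w. w \<in> verts (build h) \<Longrightarrow>
      prob (U \<inter> cyl ((v, w) # h)) \<le> g w * prob (cyl ((v, w) # h))"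
  shows "prob (U \<inter> cyl h) \<le> (\<Sum>w\<in>verts (build h). attach_prob (build h) w * g w) * prob (cyl h)"
proof -
  let ?t = "build h"
  define S where "S = Sigma (verts ?t) (neighbours ?t)"
  define n where "n = real (length h + 2)"
  have S: "finite S"
    unfolding S_def by (intro finite_SigmaI recursive_tree_finite[OF rt] finite_neighbours[OF rt])
  have disj: "disjoint_family_on (\<lambda>s. cyl (s # h)) S"
    by (auto simp: disjoint_family_on_def cyl.simps)
  have disj_U: "disjoint_family_on (\<lambda>s. U \<inter> cyl (s # h)) S"
    using disj unfolding disjoint_family_on_def by blast
  have step: "prob (cyl (s # h)) = 1 / (n * degree ?t (fst s)) * prob (cyl h)" if "s \<in> S" for s
    using that prob_cyl_Cons[OF rt, of "fst s" "snd s"] by (auto simp: S_def n_def)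
  \<comment> \<open>The finitely many possible steps exhaust \<open>cyl h\<close> up to a null set.\<close>
  have sum_S: "(\<Sum>s\<in>S. f (fst s) (snd s)) = (\<Sum>v\<in>verts ?t. \<Sum>w\<in>neighbours ?t v. f v w)"
    for f :: "nat \<Rightarrow> nat \<Rightarrow> real"
    unfolding S_def using recursive_tree_finite[OF rt] finite_neighbours[OF rt]
    by (subst sum.Sigma) (auto simp: split_beta)
  have "(\<Sum>s\<in>S. 1 / (n * degree ?t (fst s))) = 1"
    using sum_S[of "\<lambda>v w. 1 / (n * degree ?t v)"] sum_inverse_degrees[OF rt]
    unfolding n_def by (rule trans)
  moreover have "(\<Sum>s\<in>S. prob (cyl (s # h)))
      = (\<Sum>s\<in>S. 1 / (n * degree ?t (fst s)) * prob (cyl h))"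
    by (intro sum.cong refl step)
  ultimately have "(\<Sum>s\<in>S. prob (cyl (s # h))) = prob (cyl h)"
    unfolding sum_distrib_right[symmetric] by (simp)
  then have full: "prob (\<Union>s\<in>S. cyl (s # h)) = prob (cyl h)"
    using disj S by (subst finite_measure_finite_Union) auto
  have un: "(\<Union>s\<in>S. cyl (s # h)) \<in> events"
    using S by (intro sets.finite_UN) auto
  have sub: "(\<Union>s\<in>S. cyl (s # h)) \<subseteq> cyl h"
    using cyl_Cons_subset by auto
  have "prob (U \<inter> cyl h) \<le> prob ((\<Union>s\<in>S. U \<inter> cyl (s # h)) \<union> (cyl h - (\<Union>s\<in>S. cyl (s # h))))"
    using S un by (intro finite_measure_mono sets.Un sets.finite_UN sets.Diff) auto
  also have "\<dots> \<le> prob (\<Union>s\<in>S. U \<inter> cyl (s # h)) + prob (cyl h - (\<Union>s\<in>S. cyl (s # h)))"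
    using S un by (intro measure_Un_le sets.finite_UN sets.Diff) auto
  also have "prob (cyl h - (\<Union>s\<in>S. cyl (s # h))) = 0"
    using un sub full by (subst finite_measure_Diff) auto
  also have "prob (\<Union>s\<in>S. U \<inter> cyl (s # h)) = (\<Sum>s\<in>S. prob (U \<inter> cyl (s # h)))"
    using S disj_U by (intro finite_measure_finite_Union) auto
  also have "\<dots> \<le> (\<Sum>s\<in>S. g (snd s) * prob (cyl (s # h)))"
  proof (intro sum_mono)
    fix s assume "s \<in> S"
    then have "snd s \<in> verts ?t"
      using neighbours_subset_verts[of ?t "fst s"] by (auto simp: S_def)
    then show "prob (U \<inter> cyl (s # h)) \<le> g (snd s) * prob (cyl (s # h))"
      using le[of "snd s" "fst s"] by simp
  qed
  also have "\<dots> = (\<Sum>s\<in>S. g (snd s) / (n * degree ?t (fst s))) * prob (cyl h)"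
    unfolding sum_distrib_right by (intro sum.cong refl) (simp add: step)
  also have "(\<Sum>s\<in>S. g (snd s) / (n * degree ?t (fst s)))
      = (\<Sum>w\<in>verts ?t. attach_prob ?t w * g w)"
    using sum_S[of "\<lambda>v w. g w / (n * degree ?t v)"]
    unfolding sum_attach_prob_mult[OF rt] n_def .
  finally show ?thesis by simp
qed

lemma T_measurable [measurable]: "2 \<le> n \<Longrightarrow> T n \<in> measurable M (count_space UNIV)"
proof (induction n rule: nat_induct_at_least)
  case base
  have "T 2 \<in> measurable M (count_space UNIV) \<longleftrightarrow>
      (\<lambda>_. ({1, 2}, {{1, 2}}) :: graph) \<in> measurable M (count_space UNIV)"
    by (intro measurable_cong T_2)
  then show ?case by simp
next
  case (Suc n)
  note [measurable] = W_measurable[OF Suc.hyps] Suc.IH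
  have "T (n + 1) \<in> measurable M (count_space UNIV) \<longleftrightarrow>
      (\<lambda>\<omega>. add_leaf (n + 1) (W n \<omega>) (T n \<omega>)) \<in> measurable M (count_space UNIV)"
    by (intro measurable_cong T_Suc Suc.hyps)
  also have "\<dots>"
    by (rule measurable_compose_countable[where f = "\<lambda>w \<omega>. add_leaf (n + 1) w (T n \<omega>)"])
      (auto intro: measurable_compose[OF Suc.IH])
  finally show ?case by simp
qed

section \<open>Vertices of linear degree\<close>

text \<open>One parameter serves as starting time and as reciprocal of the slope, so that the
  predicate is monotone in it (\<open>linear_from_mono\<close>) and a countable union over it says that the
  degree of \<open>w\<close> is eventually at least a positive multiple of the time. The offset 3 keeps all
  times inside the range where the process is defined, and makes \<open>linear_from j\<close> imply degree
  at least 2 at time \<open>j + 3\<close>.\<close>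

definition linear_from :: "nat \<Rightarrow> 'a \<Rightarrow> nat \<Rightarrow> bool" where
  "linear_from i \<omega> w \<longleftrightarrow>
    (\<forall>k\<ge>i + 3. w \<in> verts (T k \<omega>) \<and> k \<le> (i + 1) * degree (T k \<omega>) w)"

lemma linear_from_mono:
  assumes "linear_from i \<omega> w" "i \<le> j"
  shows "linear_from j \<omega> w"
  unfolding linear_from_def
proof (intro allI impI)
  fix k assume k: "j + 3 \<le> k"
  have "(i + 1) * degree (T k \<omega>) w \<le> (j + 1) * degree (T k \<omega>) w"
    using \<open>i \<le> j\<close> by (intro mult_right_mono) auto
  moreover have "w \<in> verts (T k \<omega>) \<and> k \<le> (i + 1) * degree (T k \<omega>) w"
    using assms k by (auto simp: linear_from_def)
  ultimately show "w \<in> verts (T k \<omega>) \<and> k \<le> (j + 1) * degree (T k \<omega>) w"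
    by linarith
qed

lemma verts_T_mono:
  assumes "\<omega> \<in> space M" "2 \<le> n" "n \<le> k"
  shows "verts (T n \<omega>) \<subseteq> verts (T k \<omega>)"
  using assms(3)
proof (induction k rule: dec_induct)
  case (step k)
  then show ?case using T_Suc[of k \<omega>] assms by auto
qed simp

lemma finite_verts_T: "2 \<le> n \<Longrightarrow> \<omega> \<in> space M \<Longrightarrow> finite (verts (T n \<omega>))"
proof (induction n rule: nat_induct_at_least)
  case base
  then show ?case using T_2[of \<omega>] by (simp add: verts_def)
next
  case (Suc n)
  then show ?case using T_Suc[of n \<omega>] by simp
qed

lemma finite_neighbours_T: "2 \<le> n \<Longrightarrow> \<omega> \<in> space M \<Longrightarrow> finite (neighbours (T n \<omega>) v)"
  by (rule finite_subset[OF neighbours_subset_verts finite_verts_T])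

lemma card_leaves_at_le:
  "2 \<le> n \<Longrightarrow> \<omega> \<in> space M \<Longrightarrow> card (leaves_at (T n \<omega>) w) \<le> degree (T n \<omega>) w"
  unfolding leaves_at_def degree_def by (intro card_mono finite_neighbours_T) auto

lemma degree_T_mono:
  assumes "\<omega> \<in> space M" "2 \<le> n" "n \<le> k"
  shows "degree (T n \<omega>) v \<le> degree (T k \<omega>) v"
  using assms(3)
proof (induction k rule: dec_induct)
  case (step k)
  have "neighbours (T k \<omega>) v \<subseteq> neighbours (T (Suc k) \<omega>) v"
    using T_Suc[of k \<omega>] assms step by (auto simp: neighbours_def)
  then have "degree (T k \<omega>) v \<le> degree (T (Suc k) \<omega>) v"
    unfolding degree_def using assms step by (intro card_mono finite_neighbours_T) auto
  then show ?case using step by simp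
qed simp

section \<open>Vertices with many leaves\<close>

text \<open>With \<open>L\<close> the number of leaves at \<open>w\<close>, this is the event that \<open>k / (L - 4)\<close> reaches the level
  \<open>c\<close> in the time interval \<open>{n..K}\<close>, written without division so that it includes \<open>L \<le> 4\<close>.\<close>

definition low_upto :: "real \<Rightarrow> nat \<Rightarrow> nat \<Rightarrow> nat \<Rightarrow> 'a set" where
  "low_upto c w K n =
    {\<omega> \<in> space M. \<exists>k\<in>{n..K}. c * (real (card (leaves_at (T k \<omega>) w)) - 4) \<le> real k}"

lemma low_upto_measurable [measurable]: "2 \<le> n \<Longrightarrow> low_upto c w K n \<in> events"
proof -
  assume n: "2 \<le> n"
  have "low_upto c w K n = (\<Union>k\<in>{n..K}.
      {\<omega> \<in> space M. c * (real (card (leaves_at (T k \<omega>) w)) - 4) \<le> real k})"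
    by (auto simp: low_upto_def)
  also have "\<dots> \<in> events"
  proof (intro sets.finite_UN)
    fix k assume "k \<in> {n..K}"
    then have [measurable]: "T k \<in> measurable M (count_space UNIV)"
      using n by (intro T_measurable) auto
    show "{\<omega> \<in> space M. c * (real (card (leaves_at (T k \<omega>) w)) - 4) \<le> real k} \<in> events"
      by measurable
  qed simp
  finally show ?thesis .
qed

text \<open>With \<open>y = L - 4\<close>, the drift inequality for \<open>n / (L - 4)\<close> at the gain rate \<open>L / n\<close> and the
  loss rate \<open>1 / n\<close>. For the pure gain process \<open>n / (L - 1)\<close> would suffice; the shift by 4 absorbs
  the losses as soon as \<open>y \<ge> 2\<close>.\<close>

lemma reciprocal_drift:
  fixes y n :: real
  assumes "2 \<le> y" "0 < n"
  shows "(n + 1) * (1 / y - (1 / y - 1 / (y + 1)) * ((y + 4) / n) + (1 / (y - 1) - 1 / y) * (1 / n))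
    \<le> n / y"
proof -
  have "1 + 1 / (y - 1) \<le> (y + 4) / (y + 1)"
  proof -
    have "1 / (y - 1) \<le> 3 / (y + 1)"
      using assms by (simp add: divide_simps)
    also have "3 / (y + 1) = (y + 4) / (y + 1) - 1"
      using assms by (simp add: divide_simps)
    finally show ?thesis by simp
  qed
  then have "(n + 1) * (n - (y + 4) / (y + 1) + 1 / (y - 1)) \<le> (n + 1) * (n - 1)"
    using assms by (intro mult_left_mono) auto
  also have "\<dots> \<le> n * n"
    by (simp add: algebra_simps)
  finally have "(n + 1) * (n - (y + 4) / (y + 1) + 1 / (y - 1)) / (n * y) \<le> n * n / (n * y)"
    using assms by (intro divide_right_mono) auto
  moreover have "1 / y - (1 / y - 1 / (y + 1)) * ((y + 4) / n) + (1 / (y - 1) - 1 / y) * (1 / n)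
    = (n - (y + 4) / (y + 1) + 1 / (y - 1)) / (n * y)"
    using assms by (simp add: divide_simps)
  ultimately show ?thesis
    using assms by simp
qed

text \<open>The maximal inequality for the supermartingale \<open>k / (L - 4)\<close>, by backward induction from the
  horizon \<open>K\<close>. The hypothesis that \<open>c\<close> is at most the current time puts the states with \<open>L = 5\<close>,
  where the drift inequality fails, above the level \<open>c\<close>, where the bound is at least 1.\<close>

lemma prob_low_upto_le:
  fixes c :: real
  assumes "length h + 2 \<le> K" "0 < c" "c \<le> length h + 2"
    and "recursive_tree (length h + 2) (build h)" "w \<in> verts (build h)"
    and "5 \<le> card (leaves_at (build h) w)"
  shows "prob (low_upto c w K (length h + 2) \<inter> cyl h)
    \<le> (length h + 2) / (c * (real (card (leaves_at (build h) w)) - 4)) * prob (cyl h)"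
  using assms
proof (induction "K - (length h + 2)" arbitrary: h rule: less_induct)
  case less
  define n where "n = length h + 2"
  define t where "t = build h"
  define L where "L = card (leaves_at t w)"
  note n_def' = n_def[symmetric] and t_def' = t_def[symmetric]
  note prems = less.prems[unfolded n_def' t_def', folded L_def]
  have L5: "5 \<le> real L" and n2: "2 \<le> n"
    using prems(6) by (auto simp: n_def)
  show ?case
  proof (cases "c * (real L - 4) \<le> n")
    case True
    then have "1 \<le> n / (c * (real L - 4))"
      using prems(2) L5 by (simp add: divide_simps)
    then have "prob (cyl h) \<le> n / (c * (real L - 4)) * prob (cyl h)"
      using mult_right_mono[of 1 "n / (c * (real L - 4))" "prob (cyl h)"] by simp
    moreover have "prob (low_upto c w K n \<inter> cyl h) \<le> prob (cyl h)"
      by (intro finite_measure_mono) auto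
    ultimately show ?thesis
      unfolding n_def' t_def' L_def[symmetric] by linarith
  next
    case False
    have L6: "6 \<le> real L"
    proof (rule ccontr)
      assume "\<not> 6 \<le> real L"
      then have "L = 5" using L5 by linarith
      then show False using False prems(3) by simp
    qed
    \<comment> \<open>The level is not reached at time \<open>n\<close>, so only later times matter.\<close>
    have Suc_n: "low_upto c w K n \<inter> cyl h = low_upto c w K (Suc n) \<inter> cyl h"
    proof -
      have "{n..K} = insert n {Suc n..K}"
        using prems(1) by auto
      moreover have "T n \<omega> = t" if "\<omega> \<in> cyl h" for \<omega>
        using T_cyl[OF that] by (simp add: n_def t_def)
      ultimately show ?thesis
        using False by (auto simp: low_upto_def L_def)
    qed
    show ?thesis
    proof (cases "n = K")
      case True
      then have "low_upto c w K n \<inter> cyl h = {}"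
        unfolding Suc_n by (simp add: low_upto_def)
      then show ?thesis
        unfolding n_def' t_def' L_def[symmetric] using prems(2) L6 by simp
    next
      case n_less: False
      define L' where "L' x = real (card (leaves_at (add_leaf (Suc n) x t) w))" for x
      define m where "m = (n + 1) / c"
      define y where "y = real L - 4"
      define g where "g x = m * (1 / (L' x - 4))" for x
      define a where "a = m * (1 / y)"
      define b where "b = m * (1 / y - 1 / (y + 1))"
      define d where "d = m * (1 / (y - 1) - 1 / y)"
      have m: "0 \<le> m" using prems(2) by (simp add: m_def)
      have y: "2 \<le> y" "real L = y + 4" using L6 by (auto simp: y_def)
      have L'_eq: "L' x = (if x = w then L + 1 else if x \<in> leaves_at t w then L - 1 else L)"
        if "x \<in> verts t" for x
        using card_leaves_at_add_vertex[OF prems(4) that prems(5)] by (simp add: L'_def L_def)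
      have mean: "(\<Sum>x\<in>verts t. attach_prob t x * g x) \<le> a - b * (L / n) + d * (L / (n * degree t w))"
        unfolding L_def
      proof (rule mean_attach_le[OF prems(4,5)])
        show "0 \<le> b"
          unfolding b_def using m y by (intro mult_nonneg_nonneg) (auto simp: divide_simps)
        fix x assume "x \<in> verts t"
        then show "g x \<le> a - b * of_bool (x = w) + d * of_bool (x \<in> leaves_at t w)"
          using y not_self_leaf[OF prems(4), of w]
          by (auto simp: g_def L'_eq a_def b_def d_def of_nat_diff right_diff_distrib add.commute)
      qed
      also have "\<dots> \<le> a - b * (L / n) + d * (1 / n)"
      proof -
        have "0 \<le> d"
          unfolding d_def using m y by (intro mult_nonneg_nonneg) (auto simp: divide_simps)
        moreover have "L / (n * degree t w) \<le> 1 / n"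
          using card_leaves_at_le_degree[OF prems(4), of w] degree_pos[OF prems(4,5)] n2
          by (simp add: divide_simps L_def)
        ultimately have "d * (L / (n * degree t w)) \<le> d * (1 / n)"
          by (intro mult_left_mono)
        then show ?thesis by linarith
      qed
      also have "\<dots> = m * (1 / y - (1 / y - 1 / (y + 1)) * ((y + 4) / n) + (1 / (y - 1) - 1 / y) * (1 / n))"
        unfolding a_def b_def d_def y(2) by (simp only: ring_distribs mult.assoc)
      also have "\<dots> = (1 / c) * ((n + 1) *
          (1 / y - (1 / y - 1 / (y + 1)) * ((y + 4) / n) + (1 / (y - 1) - 1 / y) * (1 / n)))"
        by (simp add: m_def)
      also have "\<dots> \<le> (1 / c) * (n / y)"
        using reciprocal_drift[OF y(1), of "real n"] prems(2) n2
        by (intro mult_left_mono) (simp_all only: of_nat_add of_nat_1, auto)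
      finally have drift: "(\<Sum>x\<in>verts t. attach_prob t x * g x) \<le> n / (c * (real L - 4))"
        by (simp add: mult.commute y_def)
      have "prob (low_upto c w K (Suc n) \<inter> cyl h)
          \<le> (\<Sum>x\<in>verts (build h). attach_prob (build h) x * g x) * prob (cyl h)"
      proof (rule prob_le_mean)
        show "recursive_tree (length h + 2) (build h)" by (rule less.prems(4))
        show "low_upto c w K (Suc n) \<in> events"
          using n2 by simp
        fix v x assume "x \<in> verts (build h)"
        then have x: "x \<in> verts t" by (simp add: t_def)
        have succ: "length ((v, x) # h) + 2 = Suc n" "build ((v, x) # h) = add_leaf (Suc n) x t"
          by (auto simp: n_def t_def)
        have "prob (low_upto c w K (length ((v, x) # h) + 2) \<inter> cyl ((v, x) # h))
          \<le> (length ((v, x) # h) + 2) /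
            (c * (real (card (leaves_at (build ((v, x) # h)) w)) - 4)) * prob (cyl ((v, x) # h))"
        proof (rule less.hyps)
          show "recursive_tree (length ((v, x) # h) + 2) (build ((v, x) # h))"
            unfolding succ using recursive_tree.leaf[OF prems(4) x] .
          show "5 \<le> card (leaves_at (build ((v, x) # h)) w)"
            unfolding succ using L'_eq[OF x] L6 by (auto simp: L'_def split: if_splits)
        qed (use prems n_less in \<open>auto simp: n_def t_def\<close>)
        then show "prob (low_upto c w K (Suc n) \<inter> cyl ((v, x) # h)) \<le> g x * prob (cyl ((v, x) # h))"
          unfolding succ g_def L'_def m_def by simp
      qed
      also have "\<dots> \<le> n / (c * (real L - 4)) * prob (cyl h)"
        using drift unfolding t_def' by (intro mult_right_mono) auto
      finally show ?thesis
        unfolding n_def' t_def' L_def[symmetric] Suc_n by simp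
    qed
  qed
qed

text \<open>The level is chosen as twice the present value of \<open>k / (L - 4)\<close>; it is at most the present
  time because \<open>L \<ge> 6\<close>. As long as \<open>k / (L - 4)\<close> stays below it, \<open>L\<close> and with it the degree is
  bounded below by a multiple of \<open>k\<close>.\<close>

lemma prob_not_linear_many_leaves:
  assumes rt: "recursive_tree (length h + 2) (build h)" and w: "w \<in> verts (build h)"
    and L: "6 \<le> card (leaves_at (build h) w)"
    and U [measurable]: "U \<in> events" and not_linear: "\<And>\<omega> i. \<omega> \<in> U \<Longrightarrow> \<not> linear_from i \<omega> w"
  shows "prob (U \<inter> cyl h) \<le> 1 / 2 * prob (cyl h)"
proof -
  define n where "n = length h + 2"
  define y where "y = real (card (leaves_at (build h) w)) - 4"
  define c where "c = 2 * n / y"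
  have n: "2 \<le> n" and y: "2 \<le> y"
    using L by (auto simp: n_def y_def)
  then have c: "0 < c" "c \<le> n"
    by (auto simp: c_def divide_simps)
  \<comment> \<open>The level is reached by time \<open>K + n\<close>; these events increase with \<open>K\<close>.\<close>
  define A where "A K = low_upto c w (K + n) n \<inter> cyl h" for K
  have A_meas: "range A \<subseteq> events"
    using n by (auto simp: A_def)
  have A_le: "prob (A K) \<le> 1 / 2 * prob (cyl h)" for K
  proof -
    have "prob (A K) \<le> n / (c * y) * prob (cyl h)"
      using prob_low_upto_le[OF _ c(1) _ rt w, of "K + n", folded n_def y_def] c L
      by (simp add: A_def)
    then show ?thesis
      using n y by (simp add: c_def)
  qed
  have "incseq A"
    by (rule incseq_SucI) (auto simp: A_def low_upto_def)
  then have "(\<lambda>K. prob (A K)) \<longlonglongrightarrow> prob (\<Union>K. A K)"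
    by (rule finite_Lim_measure_incseq[OF A_meas])
  then have "prob (\<Union>K. A K) \<le> 1 / 2 * prob (cyl h)"
    using A_le by (intro LIMSEQ_le_const2) auto
  moreover have "U \<inter> cyl h \<subseteq> (\<Union>K. A K)"
  proof
    fix \<omega> assume \<omega>: "\<omega> \<in> U \<inter> cyl h"
    then have sp: "\<omega> \<in> space M" using cyl_subset_space by auto
    show "\<omega> \<in> (\<Union>K. A K)"
    proof (rule ccontr)
      assume not: "\<omega> \<notin> (\<Union>K. A K)"
      have high: "real k < c * (real (card (leaves_at (T k \<omega>) w)) - 4)" if "n \<le> k" for k
      proof (rule ccontr)
        assume "\<not> ?thesis"
        then have "\<omega> \<in> A (k - n)"
          using that \<omega> sp by (auto simp: A_def low_upto_def not_less intro!: bexI[of _ k])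
        then show False using not by auto
      qed
      define i where "i = max n (nat \<lceil>c\<rceil>)"
      have "linear_from i \<omega> w"
        unfolding linear_from_def
      proof (intro allI impI conjI)
        fix k assume k: "i + 3 \<le> k"
        then have nk: "n \<le> k" by (simp add: i_def)
        show "w \<in> verts (T k \<omega>)"
          using verts_T_mono[OF sp n nk] T_cyl[of \<omega> h] w \<omega> by (auto simp: n_def)
        have ci: "c \<le> real (i + 1)"
          unfolding i_def by linarith
        have "real k < c * (real (card (leaves_at (T k \<omega>) w)) - 4)"
          by (rule high[OF nk])
        also have "\<dots> \<le> c * real (degree (T k \<omega>) w)"
          using card_leaves_at_le[of k \<omega> w] n nk sp c by (intro mult_left_mono) auto
        also have "\<dots> \<le> real (i + 1) * real (degree (T k \<omega>) w)"
          using ci by (intro mult_right_mono) auto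
        finally show "k \<le> (i + 1) * degree (T k \<omega>) w"
          unfolding of_nat_mult[symmetric] of_nat_less_iff by simp
      qed
      then show False using not_linear \<omega> by auto
    qed
  qed
  then have "prob (U \<inter> cyl h) \<le> prob (\<Union>K. A K)"
    using A_meas by (intro finite_measure_mono) auto
  ultimately show ?thesis by linarith
qed

section \<open>Vertices with a leaf\<close>

text \<open>Backward induction from a horizon \<open>K\<close> so late that the bound is trivial there. It is also
  trivial at \<open>L = 0\<close>, where \<open>w\<close> is given up, and at \<open>L = 6\<close> the previous section gives
  \<open>1 / 2\<close>. In between, \<open>L\<close> has the drift at least \<open>L / n - L / (n D) \<ge> 1 / (2 n)\<close> because \<open>D \<ge> 2\<close>,
  and this outweighs the growth of the weight. \<open>C\<close> is the weight at the starting time.\<close>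

lemma prob_not_linear_few_leaves:
  assumes "length h + 2 \<le> K" "14 \<le> C" "C \<le> growth (length h + 2)" "7 * C \<le> growth K"
    and "recursive_tree (length h + 2) (build h)" "w \<in> verts (build h)" "2 \<le> degree (build h) w"
    and "card (leaves_at (build h) w) \<le> 6"
    and U: "U \<in> events" and not_linear: "\<And>\<omega> i. \<omega> \<in> U \<Longrightarrow> \<not> linear_from i \<omega> w"
  shows "prob (U \<inter> cyl h) \<le>
    (1 / 2 + growth (length h + 2) / (2 * C) * (1 - card (leaves_at (build h) w) / 7)) * prob (cyl h)"
  using assms(1-8)
proof (induction "K - (length h + 2)" arbitrary: h rule: less_induct)
  case less
  define n where "n = length h + 2"
  define t where "t = build h"
  define L where "L = card (leaves_at t w)"
  note n_def' = n_def[symmetric] and t_def' = t_def[symmetric]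
  note prems = less.prems[unfolded n_def' t_def', folded L_def]
  have n1: "1 \<le> n" by (simp add: n_def)
  have trivial: "prob (U \<inter> cyl h) \<le> r * prob (cyl h)" if "1 \<le> r" for r
  proof -
    have "prob (U \<inter> cyl h) \<le> prob (cyl h)"
      using U by (intro finite_measure_mono) auto
    then show ?thesis
      using mult_right_mono[OF that, of "prob (cyl h)"] by simp
  qed
  consider "L = 0" | "L = 6" | "1 \<le> L" "L \<le> 5" "n = K" | "1 \<le> L" "L \<le> 5" "n < K"
    using prems(1,8) by linarith
  then show ?case
  proof cases
    case 1
    then have "1 \<le> 1 / 2 + growth n / (2 * C) * (1 - L / 7)"
      using prems(2,3) by (simp add: divide_simps)
    then show ?thesis
      unfolding n_def' t_def' L_def[symmetric] by (rule trivial)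
  next
    case 2
    have "prob (U \<inter> cyl h) \<le> 1 / 2 * prob (cyl h)"
      using 2 less.prems not_linear U
      by (intro prob_not_linear_many_leaves) (auto simp: L_def t_def)
    also have "\<dots> \<le> (1 / 2 + growth n / (2 * C) * (1 - L / 7)) * prob (cyl h)"
      using 2 prems(2,3) by (intro mult_right_mono) auto
    finally show ?thesis
      unfolding n_def' t_def' L_def .
  next
    case 3
    have "7 / 2 * (1 / 7) \<le> growth K / (2 * C) * (1 - L / 7)"
      using 3 prems(2,4) by (intro mult_mono) (auto simp: divide_simps)
    then have "1 \<le> 1 / 2 + growth K / (2 * C) * (1 - L / 7)"
      by linarith
    then show ?thesis
      using 3 unfolding n_def' t_def' L_def[symmetric] by (intro trivial) simp
  next
    case 4
    define c' where "c' = growth (Suc n)"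
    have c': "14 \<le> c'" "C \<le> c'" "c' \<le> growth n + 1 / n"
      using growth_ge[of "Suc n"] growth_Suc[OF n1] prems(3) by (auto simp: c'_def)
    define L' where "L' x = card (leaves_at (add_leaf (Suc n) x t) w)" for x
    define g where "g x = 1 / 2 + c' / (2 * C) * (1 - real (L' x) / 7)" for x
    define a where "a = 1 / 2 + c' / (2 * C) * (1 - L / 7)"
    define b where "b = c' / (14 * C)"
    have b: "0 \<le> b" using c' prems(2) by (simp add: b_def)
    have L'_eq: "L' x = (if x = w then L + 1 else if x \<in> leaves_at t w then L - 1 else L)"
      if "x \<in> verts t" for x
      using card_leaves_at_add_vertex[OF prems(5) that prems(6)] by (simp add: L'_def L_def)
    have "(\<Sum>x\<in>verts t. attach_prob t x * g x) \<le> a - b * (L / n) + b * (L / (n * degree t w))"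
      unfolding L_def
    proof (rule mean_attach_le[OF prems(5,6) b])
      fix x assume "x \<in> verts t"
      then show "g x \<le> a - b * of_bool (x = w) + b * of_bool (x \<in> leaves_at t w)"
        using 4 prems(2) not_self_leaf[OF prems(5), of w]
        by (auto simp: g_def L'_eq a_def b_def of_nat_diff field_simps)
    qed
    also have "\<dots> \<le> a - b / (2 * n)"
    proof -
      have "L / (n * degree t w) \<le> L / (n * 2)"
        using prems(7) n1 by (intro divide_left_mono mult_left_mono) auto
      also have "\<dots> = L / n - L / (2 * n)"
        using n1 by (simp add: field_simps)
      also have "\<dots> \<le> L / n - 1 / (2 * n)"
        using 4 by (intro diff_left_mono divide_right_mono) auto
      finally have "b * (L / (n * degree t w)) \<le> b * (L / n - 1 / (2 * n))"
        using b by (rule mult_left_mono)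
      then show ?thesis by (simp add: algebra_simps)
    qed
    also have "\<dots> = 1 / 2 + (c' * (1 - L / 7) - c' / 14 * (1 / n)) / (2 * C)"
      using prems(2) n1 by (simp add: a_def b_def field_simps)
    also have "\<dots> \<le> 1 / 2 + (growth n * (1 - L / 7)) / (2 * C)"
    proof -
      have "c' * (1 - L / 7) \<le> (growth n + 1 / n) * (1 - L / 7)"
        using c' 4 by (intro mult_right_mono) auto
      also have "\<dots> = growth n * (1 - L / 7) + 1 / n * (1 - L / 7)"
        by (simp add: algebra_simps)
      also have "1 / n * (1 - L / 7) \<le> 1 / n * (c' / 14)"
        using c' by (intro mult_left_mono) auto
      finally have "c' * (1 - L / 7) - c' / 14 * (1 / n) \<le> growth n * (1 - L / 7)"
        by (simp add: mult.commute)
      then show ?thesis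
        using prems(2) by (simp add: divide_right_mono)
    qed
    finally have drift: "(\<Sum>x\<in>verts t. attach_prob t x * g x)
        \<le> 1 / 2 + growth n / (2 * C) * (1 - L / 7)"
      by simp
    have "prob (U \<inter> cyl h) \<le> (\<Sum>x\<in>verts (build h). attach_prob (build h) x * g x) * prob (cyl h)"
    proof (rule prob_le_mean[OF less.prems(5) U])
      fix v x assume "x \<in> verts (build h)"
      then have x: "x \<in> verts t" by (simp add: t_def)
      have succ: "length ((v, x) # h) + 2 = Suc n" "build ((v, x) # h) = add_leaf (Suc n) x t"
        by (auto simp: n_def t_def)
      have "w \<noteq> Suc n"
        using recursive_tree_verts[OF prems(5)] prems(6) by auto
      then have deg: "2 \<le> degree (add_leaf (Suc n) x t) w"
        using degree_add_vertex[OF prems(5) x, of w] prems(7) by auto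
      have card: "card (leaves_at (add_leaf (Suc n) x t) w) \<le> 6"
        using L'_eq[OF x] 4 by (auto simp: L'_def split: if_splits)
      show "prob (U \<inter> cyl ((v, x) # h)) \<le> g x * prob (cyl ((v, x) # h))"
        using less.hyps[of "(v, x) # h", unfolded succ n_def'] recursive_tree.leaf[OF prems(5) x]
          prems(2,4,6) c' deg card 4
        unfolding g_def L'_def by (simp add: c'_def)
    qed
    also have "\<dots> \<le> (1 / 2 + growth n / (2 * C) * (1 - L / 7)) * prob (cyl h)"
      using drift unfolding t_def' by (intro mult_right_mono) auto
    finally show ?thesis
      unfolding n_def' t_def' L_def .
  qed
qed

lemma prob_not_linear_one_leaf:
  assumes rt: "recursive_tree (length h + 2) (build h)"
    and w: "w \<in> verts (build h)" "2 \<le> degree (build h) w" "leaves_at (build h) w \<noteq> {}"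
    and U: "U \<in> events" and not_linear: "\<And>\<omega> i. \<omega> \<in> U \<Longrightarrow> \<not> linear_from i \<omega> w"
  shows "prob (U \<inter> cyl h) \<le> 13 / 14 * prob (cyl h)"
proof -
  define L where "L = card (leaves_at (build h) w)"
  define C where "C = growth (length h + 2)"
  have L1: "1 \<le> L"
    using w(3) finite_leaves_at[OF rt, of w] by (simp add: L_def Suc_le_eq card_gt_0_iff)
  have C: "14 \<le> C" by (simp add: C_def growth_ge)
  show ?thesis
  proof (cases "6 \<le> L")
    case True
    have "prob (U \<inter> cyl h) \<le> 1 / 2 * prob (cyl h)"
      using True by (intro prob_not_linear_many_leaves[OF rt w(1) _ U not_linear]) (simp_all add: L_def)
    also have "\<dots> \<le> 13 / 14 * prob (cyl h)"
      by (intro mult_right_mono) auto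
    finally show ?thesis .
  next
    case False
    have "eventually (\<lambda>K. 7 * C \<le> growth K \<and> length h + 2 \<le> K) sequentially"
      using growth_at_top eventually_ge_at_top
      by (intro eventually_conj) (auto simp: filterlim_at_top)
    then obtain K where K: "7 * C \<le> growth K" "length h + 2 \<le> K"
      by (auto dest: eventually_happens)
    have "prob (U \<inter> cyl h) \<le> (1 / 2 + C / (2 * C) * (1 - L / 7)) * prob (cyl h)"
      unfolding L_def using False K C rt w U not_linear
      by (subst (1) C_def, intro prob_not_linear_few_leaves) (auto simp: C_def L_def)
    also have "\<dots> \<le> 13 / 14 * prob (cyl h)"
      using L1 C by (intro mult_right_mono) auto
    finally show ?thesis .
  qed
qed

section \<open>New vertices of linear degree\<close>

text \<open>\<open>F\<close> consists of non-leaves, hence so it does at all later times, and any leaf that receives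
  the new vertex lies outside \<open>F\<close>. From then on the bound 13/14 of the previous lemma applies;
  the second summand covers the waiting time and becomes trivial at the horizon \<open>K\<close>.\<close>

lemma prob_no_new_linear_upto:
  assumes "length h + 2 \<le> K" "3 \<le> length h + 2" "recursive_tree (length h + 2) (build h)"
    and "\<And>x. x \<in> F \<Longrightarrow> 2 \<le> degree (build h) x"
    and U: "U \<in> events" and not_linear: "\<And>\<omega> i w. \<omega> \<in> U \<Longrightarrow> w \<notin> F \<Longrightarrow> \<not> linear_from i \<omega> w"
  shows "prob (U \<inter> cyl h) \<le> (13 / 14 + growth (length h + 2) / (14 * growth K)) * prob (cyl h)"
  using assms(1-4)
proof (induction "K - (length h + 2)" arbitrary: h rule: less_induct)
  case less
  define n where "n = length h + 2"
  define t where "t = build h"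
  note n_def' = n_def[symmetric] and t_def' = t_def[symmetric]
  note prems = less.prems[unfolded n_def' t_def']
  have n1: "1 \<le> n" by (simp add: n_def)
  have cK: "14 \<le> growth K"
    using prems by (intro growth_ge) auto
  show ?case
  proof (cases "n = K")
    case True
    have "prob (U \<inter> cyl h) \<le> prob (cyl h)"
      using U by (intro finite_measure_mono) auto
    then show ?thesis
      unfolding n_def' True using cK by simp
  next
    case False
    define c' where "c' = growth (Suc n)"
    have c': "14 \<le> c'" "c' \<le> growth n + 1 / n"
      using growth_ge[of "Suc n"] growth_Suc[OF n1] by (auto simp: c'_def)
    obtain w where w: "w \<in> verts t" "2 \<le> degree t w" "leaves_at t w \<noteq> {}"
      "degree t w \<le> card (leaves_at t w) + 1"
      using exists_mostly_leaves[OF prems(3,2)] by auto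
    define r where "r = c' / (14 * growth K)"
    define g where "g x = 13 / 14 + (if x \<in> leaves_at t w then 0 else r)" for x
    \<comment> \<open>For the leaves at \<open>w\<close> the waiting ends and the summand \<open>r\<close> is dropped; \<open>q\<close> is the
      probability of this.\<close>
    define q where "q = card (leaves_at t w) / (n * degree t w)"
    have "(\<Sum>x\<in>verts t. attach_prob t x * g x) \<le> 13 / 14 + r - 0 * (card (leaves_at t w) / n)
        + (- r) * q"
      unfolding q_def by (rule mean_attach_le[OF prems(3) w(1)]) (auto simp: g_def)
    also have "\<dots> \<le> 13 / 14 + r - r * (1 / (2 * n))"
    proof -
      have "real (degree t w) \<le> 2 * real (card (leaves_at t w))"
        using w(2,4) by linarith
      then have "1 / (2 * n) \<le> q"
        using n1 w(2) by (simp add: q_def divide_simps)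
      moreover have "0 \<le> r" using c' cK by (simp add: r_def)
      ultimately have "r * (1 / (2 * n)) \<le> r * q" by (rule mult_left_mono)
      then show ?thesis by simp
    qed
    also have "\<dots> = 13 / 14 + (c' - c' / (2 * n)) / (14 * growth K)"
      using n1 cK by (simp add: r_def field_simps)
    also have "\<dots> \<le> 13 / 14 + growth n / (14 * growth K)"
    proof -
      have "1 / real n \<le> c' / (2 * n)"
        using c' n1 by (simp add: divide_simps)
      then have "c' - c' / (2 * n) \<le> growth n" using c' by linarith
      then show ?thesis using cK by (simp add: divide_right_mono)
    qed
    finally have drift: "(\<Sum>x\<in>verts t. attach_prob t x * g x)
        \<le> 13 / 14 + growth n / (14 * growth K)" .
    have "prob (U \<inter> cyl h) \<le> (\<Sum>x\<in>verts (build h). attach_prob (build h) x * g x) * prob (cyl h)"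
    proof (rule prob_le_mean[OF less.prems(3) U])
      fix v x assume "x \<in> verts (build h)"
      then have x: "x \<in> verts t" by (simp add: t_def)
      have succ: "length ((v, x) # h) + 2 = Suc n" "build ((v, x) # h) = add_leaf (Suc n) x t"
        by (auto simp: n_def t_def)
      note rt' = recursive_tree.leaf[OF prems(3) x]
      have x_new: "x \<noteq> Suc n"
        using recursive_tree_verts[OF prems(3)] x by auto
      show "prob (U \<inter> cyl ((v, x) # h)) \<le> g x * prob (cyl ((v, x) # h))"
      proof (cases "x \<in> leaves_at t w")
        case True
        then have deg_x: "degree t x = 1" by (simp add: leaves_at_def)
        then have "x \<notin> F" using prems(4)[of x] by auto
        then have "prob (U \<inter> cyl ((v, x) # h)) \<le> 13 / 14 * prob (cyl ((v, x) # h))"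
          using rt' x deg_x x_new degree_add_vertex[OF prems(3) x, of x]
            leaves_at_add_vertex[OF prems(3) x x] U not_linear
          by (intro prob_not_linear_one_leaf[of _ x]) (simp_all only: succ, auto)
        then show ?thesis using True by (simp add: g_def)
      next
        case nonleaf: False
        have "2 \<le> degree (add_leaf (Suc n) x t) y" if "y \<in> F" for y
        proof -
          have "y \<in> verts t"
          proof (rule ccontr)
            assume "y \<notin> verts t"
            then have "neighbours t y = {}"
              using recursive_tree_edges[OF prems(3)] by (auto simp: neighbours_def)
            then show False using prems(4)[OF that] by (simp add: degree_def)
          qed
          then show ?thesis
            using degree_add_vertex[OF prems(3) x, of y] prems(4)[OF that]
              recursive_tree_verts[OF prems(3)] by auto
        qed
        then show ?thesis
          using less.hyps[of "(v, x) # h", unfolded succ n_def'] rt' prems(1,2) False nonleaf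
          unfolding g_def r_def c'_def by simp
      qed
    qed
    also have "\<dots> \<le> (13 / 14 + growth n / (14 * growth K)) * prob (cyl h)"
      using drift unfolding t_def' by (intro mult_right_mono) auto
    finally show ?thesis
      unfolding n_def' .
  qed
qed

lemma prob_no_new_linear:
  assumes "3 \<le> length h + 2" "\<And>x. x \<in> F \<Longrightarrow> 2 \<le> degree (build h) x"
    and U: "U \<in> events" and not_linear: "\<And>\<omega> i w. \<omega> \<in> U \<Longrightarrow> w \<notin> F \<Longrightarrow> \<not> linear_from i \<omega> w"
  shows "prob (U \<inter> cyl h) \<le> 13 / 14 * prob (cyl h)"
proof (cases "prob (cyl h) = 0")
  case True
  have "prob (U \<inter> cyl h) \<le> prob (cyl h)"
    using U by (intro finite_measure_mono) auto
  then show ?thesis using True by simp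
next
  case False
  then have rt: "recursive_tree (length h + 2) (build h)"
    by (intro recursive_tree_build) (simp add: zero_less_measure_iff)
  define c where "c = growth (length h + 2)"
  have "(\<lambda>K. (13 / 14 + c / (14 * growth K)) * prob (cyl h)) \<longlonglongrightarrow> (13 / 14 + 0) * prob (cyl h)"
    by (intro tendsto_intros real_tendsto_divide_at_top[OF tendsto_const]
        filterlim_tendsto_pos_mult_at_top[OF tendsto_const _ growth_at_top]) simp
  moreover have "\<forall>K\<ge>length h + 2. prob (U \<inter> cyl h) \<le> (13 / 14 + c / (14 * growth K)) * prob (cyl h)"
    unfolding c_def using prob_no_new_linear_upto[OF _ assms(1) rt assms(2) U not_linear] by auto
  ultimately show ?thesis
    by (intro LIMSEQ_le_const[of _ "13 / 14 * prob (cyl h)"]) auto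
qed

section \<open>A zero-one law\<close>

lemma cyl_cover: "\<omega> \<in> space M \<Longrightarrow> \<exists>h. length h = l \<and> \<omega> \<in> cyl h"
proof (induction l)
  case (Suc l)
  then obtain h where "length h = l" "\<omega> \<in> cyl h" by auto
  then show ?case
    by (intro exI[of _ "(V (l + 2) \<omega>, W (l + 2) \<omega>) # h"]) (simp add: cyl.simps)
qed simp

lemma cyl_disjoint: "length h = length h' \<Longrightarrow> \<omega> \<in> cyl h \<Longrightarrow> \<omega> \<in> cyl h' \<Longrightarrow> h = h'"
  by (induction h h' rule: list_induct2) (auto simp: cyl.simps)

text \<open>The events of the sigma-algebra generated by the history up to time \<open>n\<close>, as unions of
  atoms.\<close>

definition determined :: "nat \<Rightarrow> 'a set \<Rightarrow> bool" where
  "determined n G \<longleftrightarrow> G \<subseteq> space M \<and> (\<forall>h. length h + 2 = n \<longrightarrow> cyl h \<subseteq> G \<or> cyl h \<inter> G = {})"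

lemma determined_eq_Union:
  assumes "determined n G" "2 \<le> n"
  shows "G = (\<Union>h\<in>{h. length h + 2 = n \<and> cyl h \<subseteq> G}. cyl h)"
proof (intro equalityI subsetI)
  fix \<omega> assume \<omega>: "\<omega> \<in> G"
  then obtain h where h: "length h = n - 2" "\<omega> \<in> cyl h"
    using cyl_cover[of \<omega> "n - 2"] assms(1) by (auto simp: determined_def)
  then have "length h + 2 = n" using assms(2) by simp
  moreover from this have "cyl h \<subseteq> G"
    using assms(1) \<omega> h(2) by (auto simp: determined_def)
  ultimately show "\<omega> \<in> (\<Union>h\<in>{h. length h + 2 = n \<and> cyl h \<subseteq> G}. cyl h)"
    using h(2) by auto
qed auto

lemma determined_measurable:
  assumes "determined n G" "2 \<le> n"
  shows "G \<in> events"
  by (subst determined_eq_Union[OF assms]) (intro sets.countable_UN', auto)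

lemma determinedI:
  assumes "\<And>\<omega> \<omega>'. (\<And>k. 2 \<le> k \<Longrightarrow> k \<le> n \<Longrightarrow> T k \<omega> = T k \<omega>') \<Longrightarrow> P \<omega> \<Longrightarrow> P \<omega>'"
  shows "determined n {\<omega> \<in> space M. P \<omega>}"
  unfolding determined_def
proof (intro conjI allI impI)
  fix h :: "(nat \<times> nat) list" assume h: "length h + 2 = n"
  have "P \<omega>'" if "\<omega> \<in> cyl h" "\<omega>' \<in> cyl h" "P \<omega>" for \<omega> \<omega>'
    using assms[of \<omega> \<omega>'] T_eq_on_cyl[OF that(1,2)] that(3) h by auto
  then show "cyl h \<subseteq> {\<omega> \<in> space M. P \<omega>} \<or> cyl h \<inter> {\<omega> \<in> space M. P \<omega>} = {}"
    using cyl_subset_space[of h] by blast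
qed auto

lemma prob_Int_determined_le:
  assumes G: "determined n G" "2 \<le> n" and B [measurable]: "B \<in> events"
    and le: "\<And>h. length h + 2 = n \<Longrightarrow> prob (B \<inter> cyl h) \<le> s * prob (cyl h)" and "0 \<le> s"
  shows "prob (B \<inter> G) \<le> s * prob G"
proof -
  define S where "S = {h. length h + 2 = n \<and> cyl h \<subseteq> G}"
  have G_eq: "G = (\<Union>h\<in>S. cyl h)"
    unfolding S_def by (rule determined_eq_Union[OF G])
  have disj: "disjoint_family_on cyl S"
    unfolding disjoint_family_on_def
  proof (intro ballI impI)
    fix h h' assume "h \<in> S" "h' \<in> S" "h \<noteq> h'"
    then show "cyl h \<inter> cyl h' = {}"
      using cyl_disjoint[of h h'] by (auto simp: S_def)
  qed
  then have disj_B: "disjoint_family_on (\<lambda>h. B \<inter> cyl h) S"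
    unfolding disjoint_family_on_def by blast
  have "emeasure M (B \<inter> G) = emeasure M (\<Union>h\<in>S. B \<inter> cyl h)"
    unfolding G_eq by (rule arg_cong[where f = "emeasure M"]) auto
  also have "\<dots> = (\<integral>\<^sup>+h. emeasure M (B \<inter> cyl h) \<partial>count_space S)"
    using disj_B by (intro emeasure_UN_countable) auto
  also have "\<dots> \<le> (\<integral>\<^sup>+h. ennreal s * emeasure M (cyl h) \<partial>count_space S)"
    using le \<open>0 \<le> s\<close> by (intro nn_integral_mono)
      (auto simp: S_def emeasure_eq_measure simp flip: ennreal_mult intro!: ennreal_leI)
  also have "\<dots> = ennreal s * (\<integral>\<^sup>+h. emeasure M (cyl h) \<partial>count_space S)"
    by (intro nn_integral_cmult) auto
  also have "(\<integral>\<^sup>+h. emeasure M (cyl h) \<partial>count_space S) = emeasure M G"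
    unfolding G_eq using disj by (intro emeasure_UN_countable[symmetric]) auto
  finally show ?thesis
    using \<open>0 \<le> s\<close> by (simp add: emeasure_eq_measure flip: ennreal_mult)
qed

text \<open>An event whose conditional probabilities given late histories stay below some \<open>s < 1\<close> is null.
  For an event \<open>B\<close> given as a decreasing intersection of countable unions of finite-time events,
  this is elementary: summing over histories gives \<open>P(B) = P(B \<inter> O) \<le> s P(O)\<close> for each of these
  unions \<open>O\<close>, and \<open>P(O)\<close> tends to \<open>P(B)\<close>.\<close>

lemma prob_eq_0_if_cyl_le:
  assumes G: "\<And>i K. determined (n + K) (G i K)" "2 \<le> n" "\<And>i. incseq (G i)"
    and decseq: "decseq (\<lambda>i. \<Union>K. G i K)"
    and B: "B = (\<Inter>i. \<Union>K. G i K)"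
    and le: "\<And>h. n \<le> length h + 2 \<Longrightarrow> prob (B \<inter> cyl h) \<le> s * prob (cyl h)"
    and s: "0 \<le> s" "s < 1"
  shows "prob B = 0"
proof -
  have G_meas: "G i K \<in> events" for i K
    using determined_measurable[OF G(1)] G(2) by simp
  have O_meas: "(\<Union>K. G i K) \<in> events" for i
    using G_meas by auto
  have B_meas: "B \<in> events"
    using O_meas by (auto simp: B)
  \<comment> \<open>The limit \<open>K \<longrightarrow> \<infinity>\<close> of the bound for events determined by a finite time.\<close>
  have O_le: "prob B \<le> s * prob (\<Union>K. G i K)" for i
  proof (rule LIMSEQ_le)
    have "(\<lambda>K. prob (B \<inter> G i K)) \<longlonglongrightarrow> prob (\<Union>K. B \<inter> G i K)"
      using G(3)[of i] G_meas B_meas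
      by (intro finite_Lim_measure_incseq) (auto simp: incseq_def)
    also have "(\<Union>K. B \<inter> G i K) = B"
      by (auto simp: B)
    finally show "(\<lambda>K. prob (B \<inter> G i K)) \<longlonglongrightarrow> prob B" .
    show "(\<lambda>K. s * prob (G i K)) \<longlonglongrightarrow> s * prob (\<Union>K. G i K)"
      using G(3)[of i] G_meas
      by (intro tendsto_intros finite_Lim_measure_incseq) auto
    have "prob (B \<inter> G i K) \<le> s * prob (G i K)" for K
      by (rule prob_Int_determined_le[OF G(1) _ B_meas le s(1)]) (use G(2) in auto)
    then show "\<exists>N. \<forall>K\<ge>N. prob (B \<inter> G i K) \<le> s * prob (G i K)"
      by blast
  qed
  \<comment> \<open>The limit in \<open>i\<close> replaces the approximation on the right by \<open>B\<close> itself.\<close>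
  have "(\<lambda>i. prob (\<Union>K. G i K)) \<longlonglongrightarrow> prob (\<Inter>i. \<Union>K. G i K)"
    using decseq O_meas by (intro finite_Lim_measure_decseq) auto
  then have "prob B \<le> s * prob B"
    unfolding B[symmetric] using O_le
    by (intro LIMSEQ_le_const[OF tendsto_mult_left]) blast+
  then have "(1 - s) * prob B \<le> 0"
    by (simp add: algebra_simps)
  then show ?thesis
    using s by (simp add: mult_le_0_iff measure_le_0_iff)
qed

section \<open>Infinitely many vertices of linear degree\<close>

text \<open>Fixing the time \<open>N\<close> by which \<open>F\<close> has no leaf makes \<open>prob_no_new_linear\<close> applicable to
  every later history that is compatible with \<open>B\<close>. Restricting to \<open>w \<le> i\<close> makes the failure of
  \<open>linear_from i\<close> for all these \<open>w\<close> an increasing union of finite-time events.\<close>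

lemma null_linear_only_in:
  assumes F: "finite F" and N: "2 \<le> N"
  defines "B \<equiv> {\<omega> \<in> space M. (\<forall>x\<in>F. 2 \<le> degree (T N \<omega>) x) \<and>
    (\<forall>i w. w \<notin> F \<longrightarrow> \<not> linear_from i \<omega> w)}"
  shows "B \<in> null_sets M"
proof -
  define bad where "bad i \<omega> w k \<longleftrightarrow>
    \<not> (w \<in> verts (T k \<omega>) \<and> k \<le> (i + 1) * degree (T k \<omega>) w)" for i \<omega> w k
  define P where "P \<omega> i K \<longleftrightarrow> (\<forall>x\<in>F. 2 \<le> degree (T N \<omega>) x) \<and>
    (\<forall>w\<in>{..i} - F. \<exists>k\<in>{i + 3..K}. bad i \<omega> w k)" for \<omega> i K
  define G where "G i K = {\<omega> \<in> space M. P \<omega> i K}" for i K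
  have linear_bad: "linear_from i \<omega> w \<longleftrightarrow> (\<forall>k\<ge>i + 3. \<not> bad i \<omega> w k)" for i \<omega> w
    by (auto simp: linear_from_def bad_def)
  have inc: "incseq (G i)" for i
  proof (rule incseq_SucI)
    fix K
    have "{i + 3..K} \<subseteq> {i + 3..Suc K}" by auto
    then show "G i K \<subseteq> G i (Suc K)"
      unfolding G_def P_def by blast
  qed
  have det: "determined (N + 3 + K) (G i K)" for i K
    unfolding G_def
  proof (rule determinedI)
    fix \<omega> \<omega>' assume eq: "\<And>k. 2 \<le> k \<Longrightarrow> k \<le> N + 3 + K \<Longrightarrow> T k \<omega> = T k \<omega>'" and "P \<omega> i K"
    moreover have "T N \<omega> = T N \<omega>'"
      using N by (intro eq) auto
    moreover have "bad i \<omega> w k \<longleftrightarrow> bad i \<omega>' w k" if "k \<in> {i + 3..K}" for w k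
      using that eq[of k] by (simp add: bad_def)
    ultimately show "P \<omega>' i K"
      by (simp add: P_def)
  qed
  have Union_G: "(\<Union>K. G i K) = {\<omega> \<in> space M. (\<forall>x\<in>F. 2 \<le> degree (T N \<omega>) x) \<and>
      (\<forall>w\<in>{..i} - F. \<not> linear_from i \<omega> w)}" (is "_ = ?O") for i
  proof (intro equalityI subsetI)
    fix \<omega> assume \<omega>: "\<omega> \<in> ?O"
    then have "\<forall>w\<in>{..i} - F. \<exists>k\<ge>i + 3. bad i \<omega> w k"
      by (auto simp: linear_bad)
    then obtain f where f: "\<And>w. w \<in> {..i} - F \<Longrightarrow> i + 3 \<le> f w \<and> bad i \<omega> w (f w)"
      by metis
    have "f w \<le> Max (f ` {..i})" if "w \<in> {..i}" for w
      using that by (intro Max_ge) auto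
    then have "\<exists>k\<in>{i + 3..Max (f ` {..i})}. bad i \<omega> w k" if "w \<in> {..i} - F" for w
      using f[OF that] that by (intro bexI[of _ "f w"]) auto
    then have "\<omega> \<in> G i (Max (f ` {..i}))"
      using \<omega> by (simp add: G_def P_def)
    then show "\<omega> \<in> (\<Union>K. G i K)" by auto
  next
    fix \<omega> assume "\<omega> \<in> (\<Union>K. G i K)"
    then obtain K where K: "\<omega> \<in> space M" "P \<omega> i K" by (auto simp: G_def)
    have "\<not> linear_from i \<omega> w" if "w \<in> {..i} - F" for w
    proof -
      obtain k where "k \<in> {i + 3..K}" "bad i \<omega> w k"
        using K(2) \<open>w \<in> {..i} - F\<close> unfolding P_def by blast
      then show ?thesis by (auto simp: linear_bad)
    qed
    then show "\<omega> \<in> ?O"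
      using K by (auto simp: P_def)
  qed
  have B_eq: "B = (\<Inter>i. \<Union>K. G i K)"
  proof -
    \<comment> \<open>A vertex beyond \<open>i\<close> is reached by enlarging \<open>i\<close>, as \<open>linear_from\<close> is monotone.\<close>
    have "\<not> linear_from i \<omega> w"
      if "\<And>i. \<forall>w\<in>{..i} - F. \<not> linear_from i \<omega> w" "w \<notin> F" for i w \<omega>
      using that(1)[of "max i w"] that(2) linear_from_mono[of i \<omega> w "max i w"] by auto
    then show ?thesis
      unfolding Union_G B_def by (intro equalityI subsetI INT_I CollectI conjI) auto
  qed
  have "decseq (\<lambda>i. \<Union>K. G i K)"
    unfolding Union_G
  proof (intro decseq_SucI subsetI)
    fix i \<omega>
    have "\<not> linear_from (Suc i) \<omega> w \<Longrightarrow> \<not> linear_from i \<omega> w" for w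
      using linear_from_mono[of i \<omega> w "Suc i"] by auto
    moreover assume "\<omega> \<in> {\<omega> \<in> space M. (\<forall>x\<in>F. 2 \<le> degree (T N \<omega>) x) \<and>
      (\<forall>w\<in>{..Suc i} - F. \<not> linear_from (Suc i) \<omega> w)}"
    ultimately show "\<omega> \<in> {\<omega> \<in> space M. (\<forall>x\<in>F. 2 \<le> degree (T N \<omega>) x) \<and>
      (\<forall>w\<in>{..i} - F. \<not> linear_from i \<omega> w)}"
      by auto
  qed
  moreover have B_meas: "B \<in> events"
    unfolding B_eq using determined_measurable[OF det] by auto
  moreover have "prob (B \<inter> cyl h) \<le> 13 / 14 * prob (cyl h)" if h: "N + 3 \<le> length h + 2" for h
  proof (cases "B \<inter> cyl h = {}")
    case False
    then obtain \<omega> where \<omega>: "\<omega> \<in> B" "\<omega> \<in> cyl h" by auto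
    have "2 \<le> degree (build h) x" if "x \<in> F" for x
    proof -
      have "2 \<le> degree (T N \<omega>) x"
        using \<omega>(1) that by (simp add: B_def)
      also have "\<dots> \<le> degree (T (length h + 2) \<omega>) x"
        using \<omega>(1) N h by (intro degree_T_mono) (auto simp: B_def)
      finally show ?thesis
        using T_cyl[OF \<omega>(2)] by simp
    qed
    then show ?thesis
      using h B_meas by (intro prob_no_new_linear[where F = F]) (auto simp: B_def)
  qed simp
  ultimately have "prob B = 0"
    using det inc N by (intro prob_eq_0_if_cyl_le[where G = G and n = "N + 3" and s = "13 / 14", OF _ _ _ _ B_eq]) auto
  then show ?thesis
    using B_meas by (simp add: null_sets_def emeasure_eq_measure)
qed

lemma linear_from_uniform:
  assumes "finite S" "\<And>w. w \<in> S \<Longrightarrow> \<exists>i. linear_from i \<omega> w"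
  shows "\<exists>j. \<forall>w\<in>S. linear_from j \<omega> w"
  using assms
proof (induction S)
  case (insert w S)
  obtain i where "linear_from i \<omega> w"
    using insert.prems by blast
  moreover obtain j where "\<forall>w\<in>S. linear_from j \<omega> w"
    using insert.IH insert.prems by blast
  ultimately show ?case
    by (intro exI[of _ "max i j"]) (auto intro: linear_from_mono)
qed simp

text \<open>If the set of vertices of linear degree were finite, it could serve as \<open>F\<close>, since its elements
  have degree at least 2 from some common time on. Finite sets are enumerated by lists, so
  only countably many null sets have to be avoided.\<close>

lemma AE_infinitely_many_linear: "AE \<omega> in M. infinite {w. \<exists>i. linear_from i \<omega> w}"
proof -
  define B where "B F N = {\<omega> \<in> space M. (\<forall>x\<in>F. 2 \<le> degree (T N \<omega>) x) \<and>
    (\<forall>i w. w \<notin> F \<longrightarrow> \<not> linear_from i \<omega> w)}" for F N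
  have "B (set xs) N \<in> null_sets M" if "2 \<le> N" for xs N
    unfolding B_def by (rule null_linear_only_in[OF _ that]) simp
  then have "AE \<omega> in M. \<forall>xs N. 2 \<le> N \<longrightarrow> \<omega> \<notin> B (set xs) N"
    by (auto simp: AE_all_countable intro!: AE_not_in)
  then show ?thesis
  proof (rule AE_mp, intro AE_I2 impI notI)
    fix \<omega> assume \<omega>: "\<omega> \<in> space M" "\<forall>xs N. 2 \<le> N \<longrightarrow> \<omega> \<notin> B (set xs) N"
      and fin: "finite {w. \<exists>i. linear_from i \<omega> w}" (is "finite ?H")
    obtain j where j: "\<forall>w\<in>?H. linear_from j \<omega> w"
      using linear_from_uniform[OF fin, of \<omega>] by auto
    have "2 \<le> degree (T (j + 3) \<omega>) w" if "w \<in> ?H" for w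
    proof (rule ccontr)
      assume "\<not> ?thesis"
      then have "(j + 1) * degree (T (j + 3) \<omega>) w \<le> (j + 1) * 1"
        by (intro mult_left_mono) auto
      moreover have "j + 3 \<le> (j + 1) * degree (T (j + 3) \<omega>) w"
        using j that by (auto simp: linear_from_def)
      ultimately have "j + 3 \<le> (j + 1) * 1" by (rule order_trans[rotated])
      then show False by simp
    qed
    then have "\<omega> \<in> B ?H (j + 3)"
      using \<omega>(1) by (auto simp: B_def)
    moreover obtain xs where "set xs = ?H"
      using finite_list[OF fin] by auto
    ultimately show False
      using \<omega>(2)[rule_format, of "j + 3" xs] by simp
  qed
qed

end

theorem theorem4p6:
  fixes M :: "'a measure"
    and V W :: "nat \<Rightarrow> 'a \<Rightarrow> nat"
    and T :: "nat \<Rightarrow> 'a \<Rightarrow> graph"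
    and m :: "nat \<Rightarrow> real"
  assumes "random_friend_tree M V W T"
    and "\<And>n. n \<ge> 1 \<Longrightarrow> m n \<ge> 0"
    and "m \<in> o(\<lambda>n. real n)"
  shows "AE \<omega> in M. filterlim (\<lambda>n. num_deg_ge (T n \<omega>) (m n)) at_top sequentially"
proof -
  interpret random_friend_tree M V W T by fact
  show ?thesis
    using AE_infinitely_many_linear
  proof (rule AE_mp, intro AE_I2 impI)
    fix \<omega> assume \<omega>: "\<omega> \<in> space M" and inf: "infinite {w. \<exists>i. linear_from i \<omega> w}"
    show "filterlim (\<lambda>n. num_deg_ge (T n \<omega>) (m n)) at_top sequentially"
      unfolding filterlim_at_top
    proof
      fix Z :: nat
      obtain S where S: "finite S" "card S = Z" "S \<subseteq> {w. \<exists>i. linear_from i \<omega> w}"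
        using infinite_arbitrarily_large[OF inf] by auto
      obtain j where j: "\<And>w. w \<in> S \<Longrightarrow> linear_from j \<omega> w"
        using linear_from_uniform[OF S(1), of \<omega>] S(3) by auto
      have "eventually (\<lambda>n. norm (m n) \<le> 1 / real (j + 1) * norm (real n)) sequentially"
        by (rule landau_o.smallD[OF assms(3)]) simp
      then show "eventually (\<lambda>n. Z \<le> num_deg_ge (T n \<omega>) (m n)) sequentially"
        using eventually_ge_at_top[of "j + 3"]
      proof eventually_elim
        case (elim n)
        have "w \<in> verts (T n \<omega>) \<and> m n \<le> real (degree (T n \<omega>) w)" if "w \<in> S" for w
        proof
          have w: "w \<in> verts (T n \<omega>)" "n \<le> (j + 1) * degree (T n \<omega>) w"
            using j[OF that] elim(2) by (auto simp: linear_from_def)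
          then have "real n \<le> real (j + 1) * real (degree (T n \<omega>) w)"
            by (metis of_nat_le_iff of_nat_mult)
          then have "1 / real (j + 1) * real n \<le> real (degree (T n \<omega>) w)"
            by (simp add: divide_simps mult.commute)
          then show "m n \<le> real (degree (T n \<omega>) w)"
            using elim(1) by simp
          show "w \<in> verts (T n \<omega>)" by fact
        qed
        then show ?case
          unfolding num_deg_ge_def S(2)[symmetric]
          using finite_verts_T[OF _ \<omega>, of n] elim(2) by (intro card_mono) auto
      qed
    qed
  qed
qed

end
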